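(* Consider the system $x_{k+1}=A_kx_k+B_ku_k+w_k$, $y_k=C_kx_k+v_k$ with the Kalman filter $\hat x_{k+1}=A_k\hat x_k+B_ku_k+K_k(y_k-C_k\hat x_k)$, where the disturbances $w_k$ and the measurement noises $v_k$ are mutually independent zero-mean Gaussian white-noise processes with finite second moments. With $P_e^x$, $P_e^{\hat x}$, $P_s^x$ and $\sigma$ as defined in the context, $$P_e^x\le P_e^{\hat x}+\sigma .$$ Equivalently, $$P_s^x\ge 1-P_e^{\hat x}-\sigma .$$
   Context: System: $x_k\in\mathbb{R}^n$ is the state, $u_k\in\mathbb{R}^m$ the input, $y_k\in\mathbb{R}^{n_y}$ the measurement; $w_k$, $v_k$ and the matrices $A_k,B_k,C_k$ have compatible dimensions. Kalman filter (one-step predictor): $\hat x_k=\mathbb{E}[x_k\mid y_0,\dots,y_{k-1}]$, with gain $K_k=A_kP_kC_k^\top(C_kP_kC_k^\top+R_k)^{-1}$ (not to be confused with the horizon $K$) and prediction error covariance $P_k$ given by $P_{k+1}=A_kP_kA_k^\top+Q_k-A_kP_kC_k^\top(C_kP_kC_k^\top+R_k)^{-1}C_kP_kA_k^\top$, $P_0=\mathbb{E}[(x_0-\hat x_0)(x_0-\hat x_0)^\top]$, $Q_k=\mathbb{E}[w_kw_k^\top]$, $R_k=\mathbb{E}[v_kv_k^\top]$. Safety is characterized by a function $h:\mathbb{R}^n\to\mathbb{R}$: the system is safe at time $k$ iff $h(x_k)\ge0$. $K\in\mathbb{N}$ is the horizon, $\sigma>0$, and $\gamma>0$ is a constant associated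 with $\sigma$ such that $\mathbb{P}\big[\sup_{0\le k\le K}\|x_k-\hat x_k\|_2\le\gamma\big]\ge1-\sigma$. Define $$h_\gamma=\sup\{h(x):\ \|x-x^0\|\le\gamma\ \text{for some }x^0\in h^{-1}(\{0\})\},\qquad \hat h(x)=h(x)-h_\gamma,$$ $$P_e^x=\mathbb{P}\Big[\min_{k\in\{0,\dots,K\}}h(x_k)<0\Big],\qquad P_e^{\hat x}=\mathbb{P}\Big[\min_{k\in\{0,\dots,K\}}\hat h(\hat x_k)<0\Big],\qquad P_s^x=1-P_e^x .$$
   Formalization: The claim fails for arbitrary h; the formal version also assumes that h is continuous, that h has a zero, and that almost surely no estimate x̂_k (k≤K) lying at distance strictly less than γ from a zero of h satisfies h(x̂_k)=h_γ exactly. *)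

theory Defs
  imports "HOL-Probability.Probability"
begin

text \<open>Degenerate directions are allowed, so that covariance matrices may be singular.\<close>

definition gaussian_vector :: "'w measure \<Rightarrow> ('w \<Rightarrow> 'v::euclidean_space) \<Rightarrow> bool" where
  "gaussian_vector M X \<longleftrightarrow> X \<in> borel_measurable M \<and>
     (\<forall>c. (\<exists>\<mu>. AE \<omega> in M. c \<bullet> X \<omega> = \<mu>) \<or>
          (\<exists>\<mu> s. s > 0 \<and> distributed M lborel (\<lambda>\<omega>. c \<bullet> X \<omega>) (normal_density \<mu> s)))"

definition gaussian_white_noise :: "'w measure \<Rightarrow> (nat \<Rightarrow> 'w \<Rightarrow> 'v::euclidean_space) \<Rightarrow> bool" where
  "gaussian_white_noise M w \<longleftrightarrow>
     (\<forall>k. gaussian_vector M (w k) \<and> integrable M (\<lambda>\<omega>. (norm (w k \<omega>))\<^sup>2)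
          \<and> prob_space.expectation M (w k) = 0) \<and>
     prob_space.indep_vars M (\<lambda>_. borel) w UNIV"

text \<open>Independence of the \<open>\<sigma>\<close>-algebras generated by the two whole processes; together with the
  independence over time within each process this is joint independence of all the noise vectors.\<close>

definition independent_processes ::
    "'w measure \<Rightarrow> (nat \<Rightarrow> 'w \<Rightarrow> 'v::euclidean_space) \<Rightarrow> (nat \<Rightarrow> 'w \<Rightarrow> 'u::euclidean_space) \<Rightarrow> bool" where
  "independent_processes M w v \<longleftrightarrow>
     prob_space.indep_set M
       (sets (vimage_algebra (space M) (\<lambda>\<omega> k. w k \<omega>) (Pi\<^sub>M UNIV (\<lambda>_. borel))))
       (sets (vimage_algebra (space M) (\<lambda>\<omega> k. v k \<omega>) (Pi\<^sub>M UNIV (\<lambda>_. borel))))"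

definition second_moment_matrix :: "'w measure \<Rightarrow> ('w \<Rightarrow> real^'n) \<Rightarrow> real^'n^'n" where
  "second_moment_matrix M X = (\<chi> i j. prob_space.expectation M (\<lambda>\<omega>. X \<omega> $ i * X \<omega> $ j))"

definition past_algebra :: "'w measure \<Rightarrow> (nat \<Rightarrow> 'w \<Rightarrow> 'v::topological_space) \<Rightarrow> nat \<Rightarrow> 'w measure" where
  "past_algebra M y k = sigma (space M) (\<Union>j<k. {y j -` S \<inter> space M | S. S \<in> sets borel})"

text \<open>\<open>Z\<close> is a version of the conditional expectation of the random vector \<open>X\<close> given \<open>F\<close>.\<close>

definition is_cond_exp_vec :: "'w measure \<Rightarrow> 'w measure \<Rightarrow> ('w \<Rightarrow> real^'n) \<Rightarrow> ('w \<Rightarrow> real^'n) \<Rightarrow> bool" where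
  "is_cond_exp_vec M F X Z \<longleftrightarrow> integrable M X \<and> Z \<in> borel_measurable F \<and>
     (\<forall>i. AE \<omega> in M. Z \<omega> $ i = real_cond_exp M F (\<lambda>\<omega>. X \<omega> $ i) \<omega>)"

definition kalman_gain ::
    "real^'n^'n \<Rightarrow> real^'n^'p \<Rightarrow> real^'p^'p \<Rightarrow> real^'n^'n \<Rightarrow> real^'p^'n" where
  "kalman_gain A C R P = A ** P ** transpose C ** matrix_inv (C ** P ** transpose C + R)"

primrec kalman_cov ::
    "(nat \<Rightarrow> real^'n^'n) \<Rightarrow> (nat \<Rightarrow> real^'n^'p) \<Rightarrow> (nat \<Rightarrow> real^'n^'n) \<Rightarrow> (nat \<Rightarrow> real^'p^'p)
      \<Rightarrow> real^'n^'n \<Rightarrow> nat \<Rightarrow> real^'n^'n" where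
  "kalman_cov A C Q R P0 0 = P0"
| "kalman_cov A C Q R P0 (Suc k) =
     (let P = kalman_cov A C Q R P0 k in
      A k ** P ** transpose (A k) + Q k
      - A k ** P ** transpose (C k) ** matrix_inv (C k ** P ** transpose (C k) + R k)
          ** C k ** P ** transpose (A k))"

text \<open>The supremum may be infinite, hence extended reals.\<close>

definition h_sup :: "(real^'n \<Rightarrow> real) \<Rightarrow> real \<Rightarrow> ereal" where
  "h_sup h \<gamma> = (SUP z \<in> {z. \<exists>z0 \<in> h -` {0}. norm (z - z0) \<le> \<gamma>}. ereal (h z))"

definition h_hat :: "(real^'n \<Rightarrow> real) \<Rightarrow> real \<Rightarrow> real^'n \<Rightarrow> ereal" where
  "h_hat h \<gamma> z = ereal (h z) - h_sup h \<gamma>"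

definition failure_prob ::
    "'w measure \<Rightarrow> nat \<Rightarrow> ('s \<Rightarrow> 'r::{linorder, zero}) \<Rightarrow> (nat \<Rightarrow> 'w \<Rightarrow> 's) \<Rightarrow> real" where
  "failure_prob M K g x = measure M {\<omega> \<in> space M. (MIN k\<in>{0..K}. g (x k \<omega>)) < 0}"

definition safety_prob ::
    "'w measure \<Rightarrow> nat \<Rightarrow> ('s \<Rightarrow> 'r::{linorder, zero}) \<Rightarrow> (nat \<Rightarrow> 'w \<Rightarrow> 's) \<Rightarrow> real" where
  "safety_prob M K g x = 1 - failure_prob M K g x"

end

theory Submission
  imports Defs
begin

text \<open>If \<open>h (x k) < 0 \<le> h (xhat k)\<close>, continuity puts a zero of \<open>h\<close> on the segment from \<open>x k\<close> to
  \<open>xhat k\<close>, different from \<open>x k\<close>. As long as the estimation error is at most \<open>\<gamma>\<close>, this zero is at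
  distance less than \<open>\<gamma>\<close> from \<open>xhat k\<close>, so \<open>h (xhat k) \<le> h_sup h \<gamma>\<close>; equality is almost surely
  excluded. Hence, up to a null set, an unsafe state forces a negative \<open>h_hat\<close> at the estimate or an
  estimation error beyond \<open>\<gamma>\<close>, and a union bound concludes.\<close>

lemma zero_between:
  fixes h :: "'a::real_normed_vector \<Rightarrow> real"
  assumes "continuous_on UNIV h" and "h a < 0" and "0 \<le> h b"
  obtains z where "h z = 0" and "norm (b - z) < norm (b - a)"
proof -
  have "continuous_on {0..1} (\<lambda>t. h (a + t *\<^sub>R (b - a)))"
    by (rule continuous_on_compose2[OF assms(1)]) (auto intro!: continuous_intros)
  then obtain t where t: "0 \<le> t" "t \<le> 1" "h (a + t *\<^sub>R (b - a)) = 0"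
    using IVT'[of "\<lambda>t. h (a + t *\<^sub>R (b - a))" 0 0 1] assms by auto
  \<comment> \<open>Since \<open>h a < 0\<close>, the zero cannot sit at \<open>t = 0\<close>; the
    opposite signs separate \<open>a\<close> from \<open>b\<close>. These two facts make the final
    inequality strict.\<close>
  have "t > 0" "a \<noteq> b"
    using t assms by (auto simp: less_le)
  moreover have "b - (a + t *\<^sub>R (b - a)) = (1 - t) *\<^sub>R (b - a)"
    by (simp add: algebra_simps)
  ultimately have "norm (b - (a + t *\<^sub>R (b - a))) < norm (b - a)"
    using t by simp
  with t(3) show thesis by (rule that)
qed

lemma le_h_sup:
  assumes "h z0 = 0" and "norm (z - z0) \<le> \<gamma>"
  shows "ereal (h z) \<le> h_sup h \<gamma>"
  unfolding h_sup_def using assms by (intro SUP_upper) auto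

text \<open>A zero of \<open>h\<close> is itself a competitor in the supremum and contributes the
  value 0.\<close>

lemma h_sup_nonneg:
  assumes "h -` {0} \<noteq> {}" and "0 \<le> \<gamma>"
  shows "0 \<le> h_sup h \<gamma>"
proof -
  obtain z0 where "h z0 = 0" using assms by auto
  then show ?thesis using le_h_sup[of h z0 z0 \<gamma>] assms by (simp add: zero_ereal_def)
qed

text \<open>This covers an infinite supremum as well: \<open>h_hat\<close> is then -\<infinity>
  everywhere and both sides are true.\<close>

lemma h_hat_neg_iff:
  assumes "h -` {0} \<noteq> {}" and "0 \<le> \<gamma>"
  shows "h_hat h \<gamma> z < 0 \<longleftrightarrow> ereal (h z) < h_sup h \<gamma>"
  using h_sup_nonneg[OF assms] unfolding h_hat_def
  by (cases "h_sup h \<gamma>") (auto simp: zero_ereal_def)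

text \<open>This is the deterministic core, for one time step and one outcome, with \<open>a\<close>
  the state and \<open>b\<close> its estimate. The last premise rules out
  \<open>h_hat h \<gamma> b = 0\<close>, which would not count as a failure.\<close>

lemma h_hat_neg:
  assumes "continuous_on UNIV h" and "h -` {0} \<noteq> {}" and "0 \<le> \<gamma>"
    and "h a < 0" and "norm (a - b) \<le> \<gamma>"
    and "\<And>z0. h z0 = 0 \<Longrightarrow> norm (b - z0) < \<gamma> \<Longrightarrow> ereal (h b) \<noteq> h_sup h \<gamma>"
  shows "h_hat h \<gamma> b < 0"
proof (cases "h b < 0")
  case True
  then have "ereal (h b) < 0" by (simp add: zero_ereal_def)
  also have "0 \<le> h_sup h \<gamma>" using assms by (intro h_sup_nonneg)
  finally show ?thesis using assms by (simp add: h_hat_neg_iff)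
next
  case False
  then obtain z0 where z0: "h z0 = 0" "norm (b - z0) < norm (b - a)"
    using zero_between[of h a b] assms by auto
  \<comment> \<open>The strict bound from \<open>zero_between\<close> survives even if the error
    equals \<open>\<gamma>\<close>, so the last premise applies.\<close>
  then have "norm (b - z0) < \<gamma>" using assms(5) by (simp add: norm_minus_commute)
  then have "ereal (h b) \<le> h_sup h \<gamma>" "ereal (h b) \<noteq> h_sup h \<gamma>"
    using z0 assms(6) by (auto intro: le_h_sup)
  then show ?thesis using assms by (simp add: h_hat_neg_iff)
qed

text \<open>The generators are preimages under measurable maps, so the past forms a
  sub-\<sigma>-algebra of \<open>M\<close>. This makes events about the estimate measurable in
  \<open>M\<close>.\<close>

lemma measurable_past_algebra:
  fixes y :: "nat \<Rightarrow> 'w \<Rightarrow> 'v::topological_space"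
  assumes y: "\<And>j. j < k \<Longrightarrow> y j \<in> borel_measurable M"
    and Z: "Z \<in> borel_measurable (past_algebra M y k)"
  shows "Z \<in> borel_measurable M"
proof -
  let ?G = "\<Union>j<k. {y j -` S \<inter> space M | S. S \<in> sets borel}"
  have "?G \<subseteq> sets M" using y by (auto intro: measurable_sets)
  moreover have "?G \<subseteq> Pow (space M)" by auto
  ultimately have "subalgebra M (past_algebra M y k)"
    unfolding past_algebra_def subalgebra_def
    by (auto intro: sets.sigma_sets_subset[THEN subsetD])
  then show ?thesis using Z by (rule measurable_from_subalg)
qed

lemma borel_measurable_matrix_vector_mult [measurable]:
  fixes A :: "real^'n^'m"
  assumes "f \<in> borel_measurable M"
  shows "(\<lambda>\<omega>. A *v f \<omega>) \<in> borel_measurable M"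
  by (rule borel_measurable_continuous_on[OF _ assms])
    (auto intro: linear_continuous_on matrix_vector_mul_bounded_linear)

lemma affine_recursion_measurable:
  fixes x :: "nat \<Rightarrow> 'w \<Rightarrow> real^'n" and A :: "nat \<Rightarrow> real^'n^'n" and B :: "nat \<Rightarrow> real^'m^'n"
  assumes "x 0 \<in> borel_measurable M"
    and "\<And>k. u k \<in> borel_measurable M" and "\<And>k. w k \<in> borel_measurable M"
    and "\<And>k \<omega>. \<omega> \<in> space M \<Longrightarrow> x (Suc k) \<omega> = A k *v x k \<omega> + B k *v u k \<omega> + w k \<omega>"
  shows "x k \<in> borel_measurable M"
proof (induction k)
  case (Suc k)
  have "(\<lambda>\<omega>. A k *v x k \<omega> + B k *v u k \<omega> + w k \<omega>) \<in> borel_measurable M"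
    using Suc assms(2,3) by measurable
  then show ?case using assms(4) by (simp cong: measurable_cong)
qed (rule assms)

text \<open>A minimum over finitely many times is negative iff one entry is. The general codomain
  serves both the real \<open>h\<close> and the extended real \<open>h_hat\<close>.\<close>

lemma failure_set_eq:
  fixes x :: "nat \<Rightarrow> 'w \<Rightarrow> 's" and g :: "'s \<Rightarrow> 'r::{linorder, zero}"
  shows "{\<omega> \<in> space M. (MIN k\<in>{0..K}. g (x k \<omega>)) < 0} = (\<Union>k\<le>K. {\<omega> \<in> space M. g (x k \<omega>) < 0})"
  by (auto simp: Min_less_iff)

text \<open>The real supremum needs a nonempty index set and bounded values; the finite range
  \<open>{0..K}\<close> provides both.\<close>

lemma SUP_le_iff_ball:
  fixes f :: "nat \<Rightarrow> real"
  shows "(SUP k\<in>{0..K}. f k) \<le> c \<longleftrightarrow> (\<forall>k\<le>K. f k \<le> c)"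
  by (subst cSUP_le_iff) auto

theorem proposition3:
  fixes M :: "'w measure"
    and x xhat :: "nat \<Rightarrow> 'w \<Rightarrow> real^'n"
    and u :: "nat \<Rightarrow> 'w \<Rightarrow> real^'m"
    and y v :: "nat \<Rightarrow> 'w \<Rightarrow> real^'p"
    and w :: "nat \<Rightarrow> 'w \<Rightarrow> real^'n"
    and A Q P :: "nat \<Rightarrow> real^'n^'n"
    and B :: "nat \<Rightarrow> real^'m^'n"
    and C :: "nat \<Rightarrow> real^'n^'p"
    and R :: "nat \<Rightarrow> real^'p^'p"
    and h :: "real^'n \<Rightarrow> real"
    and K :: nat
    and \<sigma> \<gamma> :: real
  assumes "prob_space M"
    and "x 0 \<in> borel_measurable M"
    and "integrable M (\<lambda>\<omega>. (norm (x 0 \<omega>))\<^sup>2)"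
    and "\<And>k. u k \<in> borel_measurable M"
    and "gaussian_white_noise M w"
    and "gaussian_white_noise M v"
    and "independent_processes M w v"
    and "\<And>k \<omega>. \<omega> \<in> space M \<Longrightarrow> x (Suc k) \<omega> = A k *v x k \<omega> + B k *v u k \<omega> + w k \<omega>"
    and "\<And>k \<omega>. \<omega> \<in> space M \<Longrightarrow> y k \<omega> = C k *v x k \<omega> + v k \<omega>"
    and "\<And>k. Q k = second_moment_matrix M (w k)"
    and "\<And>k. R k = second_moment_matrix M (v k)"
    and "P = kalman_cov A C Q R (second_moment_matrix M (\<lambda>\<omega>. x 0 \<omega> - xhat 0 \<omega>))"
    and "\<And>k. is_cond_exp_vec M (past_algebra M y k) (x k) (xhat k)"
    and "\<And>k \<omega>. \<omega> \<in> space M \<Longrightarrow>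
           xhat (Suc k) \<omega> = A k *v xhat k \<omega> + B k *v u k \<omega>
             + kalman_gain (A k) (C k) (R k) (P k) *v (y k \<omega> - C k *v xhat k \<omega>)"
    and "\<sigma> > 0" and "\<gamma> > 0"
    and "measure M {\<omega> \<in> space M. (SUP k\<in>{0..K}. norm (x k \<omega> - xhat k \<omega>)) \<le> \<gamma>} \<ge> 1 - \<sigma>"
    and "continuous_on UNIV h"
    and "h -` {0} \<noteq> {}"
    and "AE \<omega> in M. \<forall>k\<le>K. \<forall>z0. h z0 = 0 \<and> norm (xhat k \<omega> - z0) < \<gamma>
           \<longrightarrow> ereal (h (xhat k \<omega>)) \<noteq> h_sup h \<gamma>"
  shows "failure_prob M K h x \<le> failure_prob M K (h_hat h \<gamma>) xhat + \<sigma>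
    \<and> safety_prob M K h x \<ge> 1 - failure_prob M K (h_hat h \<gamma>) xhat - \<sigma>"
proof -
  interpret prob_space M by fact
  have wv: "w k \<in> borel_measurable M" "v k \<in> borel_measurable M" for k
    using assms(5,6) by (auto simp: gaussian_white_noise_def gaussian_vector_def)
  have [measurable]: "x k \<in> borel_measurable M" for k
    using assms(2,4) wv(1) assms(8) by (rule affine_recursion_measurable)
  have "y k \<in> borel_measurable M" for k
  proof -
    have "(\<lambda>\<omega>. C k *v x k \<omega> + v k \<omega>) \<in> borel_measurable M"
      using wv(2) by measurable
    then show ?thesis using assms(9) by (simp cong: measurable_cong)
  qed
  \<comment> \<open>Measurability of the estimate is read off from its being a conditional
    expectation, rather than from the filter recursion.\<close>
  then have [measurable]: "xhat k \<in> borel_measurable M" for k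
    using assms(13)[of k] unfolding is_cond_exp_vec_def
    by (blast intro: measurable_past_algebra)
  have [measurable]: "h \<in> borel_measurable borel"
    using assms(18) by (rule borel_measurable_continuous_onI)
  have [measurable]: "h_hat h \<gamma> \<in> borel_measurable borel"
    unfolding h_hat_def by measurable

  define F where "F = {\<omega> \<in> space M. (MIN k\<in>{0..K}. h (x k \<omega>)) < 0}"
  define F' where "F' = {\<omega> \<in> space M. (MIN k\<in>{0..K}. h_hat h \<gamma> (xhat k \<omega>)) < 0}"
  define T where "T = {\<omega> \<in> space M. (SUP k\<in>{0..K}. norm (x k \<omega> - xhat k \<omega>)) \<le> \<gamma>}"
  have F'_sets: "F' \<in> sets M"
    unfolding F'_def failure_set_eq by measurable
  have T_sets: "T \<in> sets M"
    unfolding T_def SUP_le_iff_ball by measurable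
  \<comment> \<open>The inclusion holds only almost surely, because equality with
    \<open>h_sup h \<gamma>\<close> is excluded only up to a null set.\<close>
  have "AE \<omega> in M. \<omega> \<in> F \<longrightarrow> \<omega> \<in> F' \<union> (space M - T)"
    using assms(20)
  proof eventually_elim
    case (elim \<omega>)
    show ?case
    proof
      assume "\<omega> \<in> F"
      then obtain k where k: "k \<le> K" "h (x k \<omega>) < 0" "\<omega> \<in> space M"
        unfolding F_def failure_set_eq by auto
      show "\<omega> \<in> F' \<union> (space M - T)"
      proof (cases "\<omega> \<in> T")
        case True
        then have "norm (x k \<omega> - xhat k \<omega>) \<le> \<gamma>"
          using k(1) unfolding T_def SUP_le_iff_ball by auto
        then have "h_hat h \<gamma> (xhat k \<omega>) < 0"
          using assms(16,18,19) k elim by (intro h_hat_neg[where a = "x k \<omega>"]) auto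
        then show ?thesis using k unfolding F'_def failure_set_eq by auto
      qed (use k in auto)
    qed
  qed
  then have "prob F \<le> prob (F' \<union> (space M - T))"
    using F'_sets T_sets by (intro finite_measure_mono_AE) auto
  also have "\<dots> \<le> prob F' + prob (space M - T)"
    using F'_sets T_sets by (intro measure_Un_le) auto
  \<comment> \<open>The complement of \<open>T\<close> has probability \<open>1 - prob T\<close>, at
    most \<open>\<sigma>\<close> by the choice of \<open>\<gamma>\<close>.\<close>
  also have "\<dots> \<le> prob F' + \<sigma>"
    using assms(17) T_sets by (simp add: prob_compl flip: T_def)
  finally show ?thesis
    by (simp add: failure_prob_def safety_prob_def F_def F'_def)
qed

end
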